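(* Let $\mathcal N$ be a quantum channel from $\mathcal L(A')$ to $\mathcal L(B)$ with Choi matrix $J_{\mathcal N}\in\mathcal L(A\otimes B)$. The one-shot zero-error classical capacity (quantified as number of messages) of $\mathcal N$ assisted by NS$\cap$PPT codes is $$M_{0,\mathrm{NS}\cap\mathrm{PPT}}(\mathcal N)=\max\Big\{\operatorname{Tr}S_A:\ 0\le U_{AB}\le S_A\otimes\mathbb 1_B,\ \operatorname{Tr}_AU_{AB}=\mathbb 1_B,\ \operatorname{Tr}J_{\mathcal N}(S_A\otimes\mathbb 1_B-U_{AB})=0,\ 0\le U_{AB}^{T_B}\le S_A\otimes\mathbb 1_B\Big\},$$ the maximum being over Hermitian $S_A\in\mathcal L(A)$ and $U_{AB}\in\mathcal L(A\otimes B)$; and the one assisted by NS codes, $M_{0,\mathrm{NS}}(\mathcal N)$, is given by the same program with the last constraint $0\le U_{AB}^{T_B}\le S_A\otimes\mathbb 1_B$ removed. By regularization, for $\Omega\in\{\mathrm{NS},\mathrm{NS}\cap\mathrm{PPT}\}$ the $\Omega$-assisted zero-error classical capacity is $C_{0,\Omega}(\mathcal N)=\sup_{n\ge1}\frac1n\log M_{0,\Omega}(\mathcal N^{\otimes n})$.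
   Context: All Hilbert spaces are finite-dimensional, $A\cong A'$, $\log$ is base 2. $J_{\mathcal N}=\sum_{i,j}|i\rangle\langle j|_A\otimes\mathcal N(|i\rangle\langle j|_{A'})$; $T_B$ is the partial transpose on $B$. For real $\lambda\ge1$, the optimal success probabilities for transmitting $\lambda$ messages with NS$\cap$PPT codes (no-signalling and PPT-preserving bipartite operations) and with NS codes (no-signalling bipartite operations) are $$f_{\mathrm{NS}\cap\mathrm{PPT}}(\mathcal N,\lambda)=\max\{\operatorname{Tr}J_{\mathcal N}F_{AB}:\ 0\le F_{AB}\le\rho_A\otimes\mathbb 1_B,\ \operatorname{Tr}\rho_A=1,\ \operatorname{Tr}_AF_{AB}=\mathbb 1_B/\lambda,\ 0\le F_{AB}^{T_B}\le\rho_A\otimes\mathbb 1_B\},$$ and $f_{\mathrm{NS}}(\mathcal N,\lambda)$, given by the same program without the last constraint. The one-shot $\epsilon$-error capacity is $C^{(1)}_\Omega(\mathcal N,\epsilon)=\sup\{\log\lambda:\ \lambda\ge1\text{ real},\ 1-f_\Omega(\mathcal N,\lambda)\le\epsilon\}$, and the one-shot zero-error capacity quantified as messages is $M_{0,\Omega}(\mathcal N)=2^{C^{(1)}_\Omega(\mathcal N,0)}$. The formula for $C_{0,\Omega}$ is the definition of the asymptotic zero-error capacity. *)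

theory Defs
  imports
    "Jordan_Normal_Form.Schur_Decomposition"
    "HOL-Library.Extended_Real"
begin

text \<open>
  Operators on a \<open>d\<close>-dimensional Hilbert space are complex matrices in \<open>carrier_mat d d\<close>. The product
  basis of \<open>A \<otimes> B\<close> is enumerated by \<open>|i\<rangle>|k\<rangle> \<mapsto> i * dB + k\<close>, so the dimensions of tensor powers are
  ordinary natural numbers.
\<close>

definition mat_trace :: "complex mat \<Rightarrow> complex" where
  "mat_trace X = (\<Sum>i<dim_row X. X $$ (i, i))"

definition kron :: "complex mat \<Rightarrow> complex mat \<Rightarrow> complex mat" where
  "kron X Y = mat (dim_row X * dim_row Y) (dim_col X * dim_col Y)
     (\<lambda>(r, c). X $$ (r div dim_row Y, c div dim_col Y) * Y $$ (r mod dim_row Y, c mod dim_col Y))"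

definition unit_mat :: "nat \<Rightarrow> nat \<Rightarrow> nat \<Rightarrow> complex mat" where
  "unit_mat d i j = mat d d (\<lambda>(r, c). if r = i \<and> c = j then 1 else 0)"

definition hermitian_mat :: "complex mat \<Rightarrow> bool" where
  "hermitian_mat X \<longleftrightarrow> mat_adjoint X = X"

text \<open>The order on \<open>complex\<close> used below is that of \<open>Complex_Order\<close>:
  \<open>0 \<le> z\<close> says that \<open>z\<close> is real and nonnegative.\<close>

definition psd_mat :: "complex mat \<Rightarrow> bool" where
  "psd_mat X \<longleftrightarrow> hermitian_mat X \<and> (\<forall>v \<in> carrier_vec (dim_row X). 0 \<le> (X *\<^sub>v v) \<bullet>c v)"

definition loewner_le :: "complex mat \<Rightarrow> complex mat \<Rightarrow> bool" (infix \<open>\<le>\<^sub>L\<close> 50) where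
  "X \<le>\<^sub>L Y \<longleftrightarrow> dim_row X = dim_row Y \<and> dim_col X = dim_col Y \<and> psd_mat (Y - X)"

definition ptrace_A :: "nat \<Rightarrow> nat \<Rightarrow> complex mat \<Rightarrow> complex mat" where
  "ptrace_A dA dB X = mat dB dB (\<lambda>(k, l). \<Sum>i<dA. X $$ (i * dB + k, i * dB + l))"

definition ptranspose_B :: "nat \<Rightarrow> nat \<Rightarrow> complex mat \<Rightarrow> complex mat" where
  "ptranspose_B dA dB X = mat (dA * dB) (dA * dB)
     (\<lambda>(r, c). X $$ ((r div dB) * dB + c mod dB, (c div dB) * dB + r mod dB))"

text \<open>A superoperator is a function on matrices of which only the values on the carrier
  \<open>carrier_mat dA dA\<close> matter.\<close>

type_synonym superop = "complex mat \<Rightarrow> complex mat"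

definition linear_superop :: "nat \<Rightarrow> nat \<Rightarrow> superop \<Rightarrow> bool" where
  "linear_superop dA dB N \<longleftrightarrow>
     (\<forall>X \<in> carrier_mat dA dA. N X \<in> carrier_mat dB dB) \<and>
     (\<forall>X \<in> carrier_mat dA dA. \<forall>Y \<in> carrier_mat dA dA. N (X + Y) = N X + N Y) \<and>
     (\<forall>a. \<forall>X \<in> carrier_mat dA dA. N (a \<cdot>\<^sub>m X) = a \<cdot>\<^sub>m N X)"

text \<open>The tensor product of two linear maps \<open>M\<close> (from dimension \<open>d1\<close> to \<open>e1\<close>) and \<open>N\<close> (from \<open>d2\<close> to
  \<open>e2\<close>): expand \<open>X\<close> as the sum of \<open>x * (E\<^sub>i\<^sub>j \<otimes> E\<^sub>k\<^sub>l)\<close> and extend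
  \<open>E\<^sub>i\<^sub>j \<otimes> E\<^sub>k\<^sub>l \<mapsto> M E\<^sub>i\<^sub>j \<otimes> N E\<^sub>k\<^sub>l\<close> linearly.\<close>

definition tensor_superop ::
    "nat \<Rightarrow> nat \<Rightarrow> nat \<Rightarrow> nat \<Rightarrow> superop \<Rightarrow> superop \<Rightarrow> superop" where
  "tensor_superop d1 e1 d2 e2 M N X = mat (e1 * e2) (e1 * e2)
     (\<lambda>(r, c). \<Sum>i<d1. \<Sum>j<d1. \<Sum>k<d2. \<Sum>l<d2.
        X $$ (i * d2 + k, j * d2 + l) * kron (M (unit_mat d1 i j)) (N (unit_mat d2 k l)) $$ (r, c))"

fun tensor_power :: "nat \<Rightarrow> nat \<Rightarrow> superop \<Rightarrow> nat \<Rightarrow> superop" where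
  "tensor_power dA dB N 0 = (\<lambda>X. X)"
| "tensor_power dA dB N (Suc n) =
     tensor_superop dA dB (dA ^ n) (dB ^ n) N (tensor_power dA dB N n)"

definition completely_positive :: "nat \<Rightarrow> nat \<Rightarrow> superop \<Rightarrow> bool" where
  "completely_positive dA dB N \<longleftrightarrow>
     (\<forall>k. \<forall>X \<in> carrier_mat (k * dA) (k * dA).
        psd_mat X \<longrightarrow> psd_mat (tensor_superop k k dA dB (\<lambda>Y. Y) N X))"

definition quantum_channel :: "nat \<Rightarrow> nat \<Rightarrow> superop \<Rightarrow> bool" where
  "quantum_channel dA dB N \<longleftrightarrow>
     linear_superop dA dB N \<and> completely_positive dA dB N \<and>
     (\<forall>X \<in> carrier_mat dA dA. mat_trace (N X) = mat_trace X)"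

definition choi_mat :: "nat \<Rightarrow> nat \<Rightarrow> superop \<Rightarrow> complex mat" where
  "choi_mat dA dB N = mat (dA * dB) (dA * dB)
     (\<lambda>(r, c). \<Sum>i<dA. \<Sum>j<dA. kron (unit_mat dA i j) (N (unit_mat dA i j)) $$ (r, c))"

datatype assistance = NS | NS_PPT

text \<open>The supremum below is the maximum of the program: for \<open>l \<ge> 1\<close> the feasible set is compact, and
  nonempty since it contains \<open>F = (\<rho> \<otimes> 1) / l\<close>. All traces \<open>Tr (J F)\<close> are real.\<close>

definition success_prob :: "assistance \<Rightarrow> nat \<Rightarrow> nat \<Rightarrow> superop \<Rightarrow> real \<Rightarrow> real" where
  "success_prob \<Omega> dA dB N l = Sup {Re (mat_trace (choi_mat dA dB N * F)) | F \<rho>.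
     F \<in> carrier_mat (dA * dB) (dA * dB) \<and> \<rho> \<in> carrier_mat dA dA \<and>
     0\<^sub>m (dA * dB) (dA * dB) \<le>\<^sub>L F \<and> F \<le>\<^sub>L kron \<rho> (1\<^sub>m dB) \<and>
     mat_trace \<rho> = 1 \<and>
     ptrace_A dA dB F = complex_of_real (1 / l) \<cdot>\<^sub>m 1\<^sub>m dB \<and>
     (\<Omega> = NS_PPT \<longrightarrow>
        0\<^sub>m (dA * dB) (dA * dB) \<le>\<^sub>L ptranspose_B dA dB F \<and>
        ptranspose_B dA dB F \<le>\<^sub>L kron \<rho> (1\<^sub>m dB))}"

text \<open>Suprema of capacities are taken in \<open>ereal\<close>, so that no boundedness is presupposed
  (for \<open>\<epsilon> \<ge> 1\<close> the one-shot capacity is infinite).\<close>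

definition one_shot_capacity :: "assistance \<Rightarrow> nat \<Rightarrow> nat \<Rightarrow> superop \<Rightarrow> real \<Rightarrow> ereal" where
  "one_shot_capacity \<Omega> dA dB N \<epsilon> =
     Sup {ereal (log 2 l) | l. 1 \<le> l \<and> 1 - success_prob \<Omega> dA dB N l \<le> \<epsilon>}"

fun exp2_ereal :: "ereal \<Rightarrow> ereal" where
  "exp2_ereal (ereal x) = ereal (2 powr x)"
| "exp2_ereal PInfty = \<infinity>"
| "exp2_ereal MInfty = 0"

text \<open>The inverse of \<open>exp2_ereal\<close>; the value at negative arguments is never used.\<close>

fun log2_ereal :: "ereal \<Rightarrow> ereal" where
  "log2_ereal (ereal x) = (if 0 < x then ereal (log 2 x) else - \<infinity>)"
| "log2_ereal PInfty = \<infinity>"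
| "log2_ereal MInfty = - \<infinity>"

definition zero_error_messages :: "assistance \<Rightarrow> nat \<Rightarrow> nat \<Rightarrow> superop \<Rightarrow> ereal" where
  "zero_error_messages \<Omega> dA dB N = exp2_ereal (one_shot_capacity \<Omega> dA dB N 0)"

definition zero_error_capacity :: "assistance \<Rightarrow> nat \<Rightarrow> nat \<Rightarrow> superop \<Rightarrow> ereal" where
  "zero_error_capacity \<Omega> dA dB N = (SUP n \<in> {1..}. ereal (1 / real n) *
     log2_ereal (zero_error_messages \<Omega> (dA ^ n) (dB ^ n) (tensor_power dA dB N n)))"

definition is_maximum :: "real \<Rightarrow> real set \<Rightarrow> bool" where
  "is_maximum m V \<longleftrightarrow> m \<in> V \<and> (\<forall>v \<in> V. v \<le> m)"

end

theory Submission
  imports "HOL-Analysis.Function_Topology" "HOL-Analysis.Topology_Euclidean_Space" Defs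
begin

text \<open>
  A code \<open>(F, \<rho>)\<close> for \<open>\<lambda>\<close> messages corresponds to the pair \<open>(S, U) = (\<lambda> \<rho>, \<lambda> F)\<close>, with \<open>Tr S = \<lambda>\<close>. Trace
  preservation gives \<open>Tr J (S \<otimes> 1) = Tr S\<close>, so the success probability of the code is
  \<open>1 - Tr J (S \<otimes> 1 - U) / \<lambda>\<close>, where \<open>Tr J (S \<otimes> 1 - U)\<close> is nonnegative because \<open>J\<close> and \<open>S \<otimes> 1 - U\<close> are
  positive. Both optimal values are attained by compactness (for the zero-error program, \<open>Tr S = Tr J U\<close>
  is bounded since the diagonal entries of \<open>U\<close> are at most 1). Hence the \<open>\<lambda> \<ge> 1\<close> with optimal success
  probability 1 are exactly the values of the zero-error program; they are automatically at least 1, as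
  the partial trace of \<open>U \<le> S \<otimes> 1\<close> gives \<open>1 \<le> (Tr S) 1\<close>.
\<close>

section \<open>Positive semidefinite matrices\<close>

definition qform :: "nat \<Rightarrow> (nat \<Rightarrow> nat \<Rightarrow> complex) \<Rightarrow> (nat \<Rightarrow> complex) \<Rightarrow> complex" where
  "qform n f v = (\<Sum>i<n. \<Sum>j<n. f i j * v j * cnj (v i))"

text \<open>Entries form a function on indices and the size is a parameter, so that inductions on
  the size can restrict and modify kernels freely. The real part suffices because the form of a
  Hermitian kernel is real (\<open>qform_sym_real\<close>).\<close>

definition psd_kernel :: "nat \<Rightarrow> (nat \<Rightarrow> nat \<Rightarrow> complex) \<Rightarrow> bool" where
  "psd_kernel n f \<longleftrightarrow> (\<forall>i<n. \<forall>j<n. f j i = cnj (f i j)) \<and> (\<forall>v. 0 \<le> Re (qform n f v))"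

lemma psd_kernel_sym: "psd_kernel n f \<Longrightarrow> i < n \<Longrightarrow> j < n \<Longrightarrow> f j i = cnj (f i j)"
  unfolding psd_kernel_def by blast

lemma psd_kernel_qform: "psd_kernel n f \<Longrightarrow> 0 \<le> Re (qform n f v)"
  unfolding psd_kernel_def by blast

lemma sum_pair_support:
  fixes f :: "nat \<Rightarrow> 'a::comm_monoid_add"
  assumes "i < n" "j < n" "i \<noteq> j" "\<And>k. k < n \<Longrightarrow> k \<noteq> i \<Longrightarrow> k \<noteq> j \<Longrightarrow> f k = 0"
  shows "(\<Sum>k<n. f k) = f i + f j"
proof -
  have "(\<Sum>k<n. f k) = sum f {i, j}"
    using assms by (intro sum.mono_neutral_right) auto
  with assms show ?thesis by simp
qed

text \<open>Evaluating the form at a vector supported on \<open>i\<close> and \<open>j\<close>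
  extracts the positivity of a 2 by 2 principal block.\<close>

lemma psd_kernel_pair:
  assumes f: "psd_kernel n f" and ij: "i < n" "j < n" "i \<noteq> j"
  shows "0 \<le> Re (f i i) * (cmod x)\<^sup>2 + Re (f j j) * (cmod y)\<^sup>2 + 2 * Re (f i j * y * cnj x)"
proof -
  define v where "v = (\<lambda>k. if k = i then x else if k = j then y else 0)"
  have "qform n f v = (\<Sum>a<n. f a i * v i * cnj (v a) + f a j * v j * cnj (v a))"
    unfolding qform_def
    by (intro sum.cong refl sum_pair_support) (use ij in \<open>auto simp: v_def\<close>)
  also have "\<dots> = (f i i * v i * cnj (v i) + f i j * v j * cnj (v i))
      + (f j i * v i * cnj (v j) + f j j * v j * cnj (v j))"
    by (intro sum_pair_support) (use ij in \<open>auto simp: v_def\<close>)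
  also have "\<dots> = f i i * (x * cnj x) + f j j * (y * cnj y) + (f i j * y * cnj x + cnj (f i j * y * cnj x))"
    using ij psd_kernel_sym[OF f, of i j] by (auto simp: v_def algebra_simps)
  also have "Re \<dots> = Re (f i i) * (cmod x)\<^sup>2 + Re (f j j) * (cmod y)\<^sup>2 + 2 * Re (f i j * y * cnj x)"
    by (simp add: complex_norm_square[symmetric] complex_add_cnj del: complex_cnj_mult of_real_power flip: of_real_power)
  finally show ?thesis using psd_kernel_qform[OF f] by metis
qed

lemma psd_kernel_diag:
  assumes f: "psd_kernel n f" and i: "i < n"
  shows "0 \<le> Re (f i i)" "Im (f i i) = 0"
proof -
  define v where "v = (\<lambda>k. if k = i then 1 else 0 :: complex)"
  have "qform n f v = (\<Sum>a<n. if a = i then f i i else 0)"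
    unfolding qform_def
  proof (intro sum.cong refl)
    fix a
    have "(\<Sum>j<n. f a j * v j * cnj (v a)) = (\<Sum>j<n. if j = i then f a i * cnj (v a) else 0)"
      by (intro sum.cong refl) (simp add: v_def)
    then show "(\<Sum>j<n. f a j * v j * cnj (v a)) = (if a = i then f i i else 0)"
      using i by (simp add: v_def)
  qed
  then have "qform n f v = f i i" using i by simp
  then show "0 \<le> Re (f i i)" using psd_kernel_qform[OF f] by metis
  show "Im (f i i) = 0" using psd_kernel_sym[OF f i i] by (simp add: complex_eq_iff)
qed

text \<open>Testing with 1 at \<open>i\<close> and, at \<open>j\<close>, a phase that turns
  \<open>f i j\<close> into minus its modulus gives 2 |f i j| <= f i i + f j j <= 2 c.\<close>

lemma psd_kernel_entry_le:
  assumes f: "psd_kernel n f" and ij: "i < n" "j < n"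
    and c: "Re (f i i) \<le> c" "Re (f j j) \<le> c"
  shows "cmod (f i j) \<le> c"
proof (cases "i = j")
  case True
  with psd_kernel_diag[OF f ij(1)] c show ?thesis
    by (simp add: cmod_def)
next
  case False
  \<comment> \<open>For a zero entry \<open>sgn\<close> gives 0 rather than a phase; modulus at most
    1 is enough below.\<close>
  define y where "y = - sgn (cnj (f i j))"
  have "f i j * y = - complex_of_real (cmod (f i j))"
  proof (cases "f i j = 0")
    case False
    have "f i j * cnj (f i j) = complex_of_real (cmod (f i j)) * complex_of_real (cmod (f i j))"
      by (simp add: complex_norm_square[symmetric] power2_eq_square)
    with False show ?thesis
      by (simp add: y_def sgn_div_norm scaleR_conv_of_real field_simps)
  qed simp
  moreover have "cmod y \<le> 1" by (simp add: y_def norm_sgn)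
  then have "(cmod y)\<^sup>2 \<le> 1" by (simp add: power_le_one)
  then have "Re (f j j) * (cmod y)\<^sup>2 \<le> Re (f j j)"
    using psd_kernel_diag[OF f ij(2)] by (simp add: mult_left_le)
  ultimately show ?thesis
    using psd_kernel_pair[OF f ij False, of 1 y] c by simp
qed

text \<open>At \<open>x = 1\<close> and \<open>y = - t * cnj (f i j)\<close> the term quadratic in
  \<open>y\<close> is absent, so the form is affine in \<open>t\<close>, with negative slope unless
  \<open>f i j\<close> vanishes.\<close>

lemma psd_kernel_zero_diag:
  assumes f: "psd_kernel n f" and ij: "i < n" "j < n" and z: "f j j = 0"
  shows "f i j = 0"
proof (cases "i = j")
  case False
  define a where "a = (cmod (f i j))\<^sup>2"
  show ?thesis
  proof (rule ccontr)
    assume nz: "f i j \<noteq> 0"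
    then have a: "a > 0" by (simp add: a_def)
    \<comment> \<open>This \<open>t\<close> makes the form equal to \<open>- Re (f i i) - 2\<close>,
      which is negative.\<close>
    define t where "t = (Re (f i i) + 1) / a"
    have "f i j * (- complex_of_real t * cnj (f i j)) = - complex_of_real (t * a)"
      by (simp add: a_def complex_norm_square del: of_real_power)
    then have "0 \<le> Re (f i i) - 2 * (t * a)"
      using psd_kernel_pair[OF f ij False, of 1 "- complex_of_real t * cnj (f i j)"] z
      by (simp del: mult_minus_left of_real_mult add: mult.assoc)
    also have "t * a = Re (f i i) + 1" using a by (simp add: t_def)
    finally show False using psd_kernel_diag[OF f ij(1)] by simp
  qed
qed (use z in simp)

lemma qform_Suc:
  "qform (Suc n) f v = qform n f v + (\<Sum>i<n. f i n * cnj (v i)) * v n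
     + (\<Sum>j<n. f n j * v j) * cnj (v n) + f n n * v n * cnj (v n)"
  by (simp add: qform_def sum.distrib sum_distrib_right sum_distrib_left distrib_right add_ac mult_ac)

text \<open>Completing the square: extending \<open>v\<close> by the last coordinate
  \<open>- s / f n n\<close> cancels the mixed terms, and the form of \<open>f\<close> there is the
  form of the complement at \<open>v\<close>.\<close>

lemma psd_kernel_schur_complement:
  assumes f: "psd_kernel (Suc n) f" and nz: "f n n \<noteq> 0"
  shows "psd_kernel n (\<lambda>i j. f i j - f i n * f n j / f n n)"
  unfolding psd_kernel_def
proof (intro conjI allI impI)
  have sym: "f j i = cnj (f i j)" if "i \<le> n" "j \<le> n" for i j
    by (rule psd_kernel_sym[OF f]) (use that in auto)
  fix i j assume "i < n" "j < n"
  then show "f j i - f j n * f n i / f n n = cnj (f i j - f i n * f n j / f n n)"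
    using sym[of i j] sym[of n j] sym[of i n] sym[of n n] by (simp add: mult.commute)
next
  have sym: "f j i = cnj (f i j)" if "i \<le> n" "j \<le> n" for i j
    by (rule psd_kernel_sym[OF f]) (use that in auto)
  fix v
  define s where "s = (\<Sum>j<n. f n j * v j)"
  have s': "(\<Sum>i<n. f i n * cnj (v i)) = cnj s"
    unfolding s_def cnj_sum by (intro sum.cong refl) (subst sym[of n], auto)
  define w where "w = v(n := - s / f n n)"
  have qw: "qform n g w = qform n g v" for g
    unfolding qform_def w_def by (intro sum.cong refl) auto
  have an: "cnj (f n n) = f n n" using sym[of n n] by simp
  have "qform (Suc n) f w = qform n f v - cnj s * s / f n n"
  proof -
    have "(\<Sum>j<n. f n j * w j) = s" unfolding s_def w_def by simp
    moreover have "(\<Sum>i<n. f i n * cnj (w i)) = cnj s" unfolding s'[symmetric] w_def by simp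
    ultimately show ?thesis
      unfolding qform_Suc qw using nz an by (simp add: w_def)
  qed
  also have "\<dots> = qform n (\<lambda>i j. f i j - f i n * f n j / f n n) v"
  proof -
    have "cnj s * s / f n n = (\<Sum>i<n. \<Sum>j<n. f i n * f n j / f n n * v j * cnj (v i))"
      unfolding s'[symmetric] unfolding s_def sum_product sum_divide_distrib
      by (intro sum.cong refl) simp
    then show ?thesis
      by (simp add: qform_def sum_subtractf left_diff_distrib)
  qed
  finally show "0 \<le> Re (qform n (\<lambda>i j. f i j - f i n * f n j / f n n) v)"
    using psd_kernel_qform[OF f] by metis
qed

lemma psd_kernel_restrict:
  assumes f: "psd_kernel (Suc n) f" shows "psd_kernel n f"
  unfolding psd_kernel_def
proof (intro conjI allI impI)
  fix v
  have "qform (Suc n) f (v(n := 0)) = qform n f v"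
    unfolding qform_Suc by (simp add: qform_def)
  then show "0 \<le> Re (qform n f v)" using psd_kernel_qform[OF f] by metis
qed (auto intro: psd_kernel_sym[OF f])

text \<open>Induction on the size: the last column gives a rank one kernel
  \<open>u i * cnj (u j)\<close>, and the remainder is the Schur complement padded by zeros. As x /
  0 = 0, the same formulas cover \<open>f n n = 0\<close>, where nothing is subtracted.\<close>

lemma psd_kernel_cholesky:
  assumes "psd_kernel n f"
  shows "\<exists>w. \<forall>i<n. \<forall>j<n. f i j = (\<Sum>k<n. w k i * cnj (w k j))"
  using assms
proof (induction n arbitrary: f)
  case (Suc n)
  note f = Suc.prems
  define a where "a = Re (f n n)"
  have fnn: "f n n = complex_of_real a" and a: "a \<ge> 0"
    using psd_kernel_diag[OF f, of n] by (auto simp: a_def complex_eq_iff)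
  have sym: "f j i = cnj (f i j)" if "i \<le> n" "j \<le> n" for i j
    by (rule psd_kernel_sym[OF f]) (use that in auto)
  define u where "u i = f i n / complex_of_real (sqrt a)" for i
  have psd: "psd_kernel n (\<lambda>i j. f i j - f i n * f n j / f n n)"
    using psd_kernel_schur_complement[OF f] psd_kernel_restrict[OF f] by (cases "f n n = 0") auto
  have u: "f i n * f n j / f n n = u i * cnj (u j)" if "i \<le> n" "j \<le> n" for i j
  proof -
    have "complex_of_real (sqrt a) * complex_of_real (sqrt a) = complex_of_real a"
      using a by (simp flip: of_real_mult)
    then show ?thesis using sym[of j n] that by (simp add: u_def fnn)
  qed
  \<comment> \<open>The rank one term reproduces the last row and column; if
    \<open>f n n = 0\<close>, both sides are 0 by \<open>psd_kernel_zero_diag\<close>.\<close>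
  have un: "f i n * f n j / f n n = f i j" if "i = n \<or> j = n" "i \<le> n" "j \<le> n" for i j
    using that psd_kernel_zero_diag[OF f, of i n] psd_kernel_zero_diag[OF f, of j n] sym[of j n]
    by (cases "f n n = 0") auto
  from Suc.IH[OF psd] obtain w where
    w: "\<And>i j. i < n \<Longrightarrow> j < n \<Longrightarrow> f i j - f i n * f n j / f n n = (\<Sum>k<n. w k i * cnj (w k j))" by auto
  define w' where "w' k i = (if k = n then u i else if i = n then 0 else w k i)" for k i
  have "f i j = (\<Sum>k<Suc n. w' k i * cnj (w' k j))" if "i < Suc n" "j < Suc n" for i j
  proof (cases "i = n \<or> j = n")
    case True
    then have "(\<Sum>k<n. w' k i * cnj (w' k j)) = 0" by (intro sum.neutral) (auto simp: w'_def)
    with True that u[of i j] un[of i j] show ?thesis by (simp add: w'_def)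
  next
    case False
    then have "(\<Sum>k<n. w' k i * cnj (w' k j)) = (\<Sum>k<n. w k i * cnj (w k j))"
      by (intro sum.cong) (auto simp: w'_def)
    with False that u[of i j] w[of i j] show ?thesis by (simp add: w'_def algebra_simps)
  qed
  then show ?case by blast
qed simp

text \<open>Writing \<open>f\<close> as a sum of rank one kernels turns the trace of the product
  into the sum of the values of the form of \<open>g\<close> at the vectors
  \<open>w k\<close>.\<close>

lemma psd_kernel_trace_mult:
  assumes "psd_kernel n f" and g: "psd_kernel n g"
  shows "0 \<le> Re (\<Sum>i<n. \<Sum>j<n. f i j * g j i)"
proof -
  from psd_kernel_cholesky[OF assms(1)] obtain w where
    w: "\<And>i j. i < n \<Longrightarrow> j < n \<Longrightarrow> f i j = (\<Sum>k<n. w k i * cnj (w k j))" by auto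
  have "(\<Sum>i<n. \<Sum>j<n. f i j * g j i) = (\<Sum>i<n. \<Sum>j<n. \<Sum>k<n. g j i * w k i * cnj (w k j))"
    by (intro sum.cong refl) (simp add: w sum_distrib_right sum_distrib_left mult_ac)
  also have "\<dots> = (\<Sum>k<n. qform n g (w k))"
  proof -
    have "(\<Sum>i<n. \<Sum>j<n. \<Sum>k<n. g j i * w k i * cnj (w k j))
        = (\<Sum>j<n. \<Sum>i<n. \<Sum>k<n. g j i * w k i * cnj (w k j))" by (rule sum.swap)
    also have "\<dots> = (\<Sum>j<n. \<Sum>k<n. \<Sum>i<n. g j i * w k i * cnj (w k j))"
      by (intro sum.cong refl sum.swap)
    also have "\<dots> = (\<Sum>k<n. \<Sum>j<n. \<Sum>i<n. g j i * w k i * cnj (w k j))"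
      by (rule sum.swap)
    finally show ?thesis by (simp add: qform_def)
  qed
  finally show ?thesis using psd_kernel_qform[OF g] by (simp add: sum_nonneg)
qed

section \<open>Transfer between matrices and kernels\<close>

lemma mat_adjoint_carrier: "X \<in> carrier_mat n n \<Longrightarrow> mat_adjoint X \<in> carrier_mat n n"
  unfolding mat_adjoint_def by auto

lemma mat_adjoint_index:
  "X \<in> carrier_mat n n \<Longrightarrow> i < n \<Longrightarrow> j < n \<Longrightarrow> mat_adjoint X $$ (i, j) = cnj (X $$ (j, i))"
  unfolding mat_adjoint_def by (auto simp: mat_of_rows_index)

lemma hermitian_mat_iff:
  assumes X: "X \<in> carrier_mat n n"
  shows "hermitian_mat X \<longleftrightarrow> (\<forall>i<n. \<forall>j<n. X $$ (j, i) = cnj (X $$ (i, j)))"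
proof
  assume "hermitian_mat X"
  then show "\<forall>i<n. \<forall>j<n. X $$ (j, i) = cnj (X $$ (i, j))"
    unfolding hermitian_mat_def using mat_adjoint_index[OF X] by metis
next
  assume "\<forall>i<n. \<forall>j<n. X $$ (j, i) = cnj (X $$ (i, j))"
  then have "cnj (X $$ (j, i)) = X $$ (i, j)" if "i < n" "j < n" for i j
    using that by (metis complex_cnj_cnj)
  then show "hermitian_mat X"
    unfolding hermitian_mat_def using mat_adjoint_carrier[OF X] X
    by (intro eq_matI) (auto simp: mat_adjoint_index[OF X] simp del: complex_cnj_cancel_iff)
qed

lemma mat_qform:
  assumes X: "X \<in> carrier_mat n n"
  shows "(X *\<^sub>v vec n v) \<bullet>c vec n v = qform n (\<lambda>i j. X $$ (i, j)) v"
  using X by (auto simp: scalar_prod_def qform_def sum_distrib_right atLeast0LessThan intro!: sum.cong)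

lemma qform_sym_real:
  assumes "\<And>i j. i < n \<Longrightarrow> j < n \<Longrightarrow> f j i = cnj (f i j)"
  shows "Im (qform n f v) = 0"
proof -
  have "cnj (qform n f v) = (\<Sum>i<n. \<Sum>j<n. f j i * v i * cnj (v j))"
    unfolding qform_def cnj_sum
    by (intro sum.cong refl) (subst assms, auto)
  also have "\<dots> = qform n f v" unfolding qform_def by (rule sum.swap)
  finally show ?thesis by (simp add: complex_eq_iff)
qed

text \<open>Functions parametrise the vectors of the carrier through \<open>vec n\<close>, and
  Hermitian symmetry removes the imaginary part that the complex order also constrains.\<close>

lemma psd_mat_iff:
  assumes X: "X \<in> carrier_mat n n"
  shows "psd_mat X \<longleftrightarrow> psd_kernel n (\<lambda>i j. X $$ (i, j))"
proof -
  have "(\<forall>v \<in> carrier_vec n. 0 \<le> (X *\<^sub>v v) \<bullet>c v) \<longleftrightarrow> (\<forall>v. 0 \<le> (X *\<^sub>v vec n v) \<bullet>c vec n v)"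
  proof (intro iffI ballI allI)
    fix v :: "complex vec"
    assume "v \<in> carrier_vec n"
    then have v: "vec n (($) v) = v" by auto
    assume "\<forall>v. 0 \<le> (X *\<^sub>v vec n v) \<bullet>c vec n v"
    then show "0 \<le> (X *\<^sub>v v) \<bullet>c v" using v by metis
  qed simp
  moreover have "dim_row X = n" using X by auto
  ultimately show ?thesis
    using qform_sym_real[of n "\<lambda>i j. X $$ (i, j)"] unfolding psd_mat_def psd_kernel_def hermitian_mat_iff[OF X] mat_qform[OF X]
    by (smt (verit) less_eq_complex_def zero_complex.simps)
qed

lemma psd_mat_add:
  assumes X: "X \<in> carrier_mat n n" "psd_mat X" and Y: "Y \<in> carrier_mat n n" "psd_mat Y"
  shows "psd_mat (X + Y)"
proof -
  have XY: "X + Y \<in> carrier_mat n n" using X Y by simp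
  note kX = X(2)[unfolded psd_mat_iff[OF X(1)]] and kY = Y(2)[unfolded psd_mat_iff[OF Y(1)]]
  have "qform n (\<lambda>i j. (X + Y) $$ (i, j)) v
      = qform n (\<lambda>i j. X $$ (i, j)) v + qform n (\<lambda>i j. Y $$ (i, j)) v" for v
    unfolding qform_def sum.distrib[symmetric]
    by (intro sum.cong refl) (use X Y in \<open>auto simp: distrib_right\<close>)
  moreover have "(X + Y) $$ (j, i) = cnj ((X + Y) $$ (i, j))" if "i < n" "j < n" for i j
  proof -
    have "(X + Y) $$ (a, b) = X $$ (a, b) + Y $$ (a, b)" if "a < n" "b < n" for a b
      using X Y that by auto
    with that psd_kernel_sym[OF kX that] psd_kernel_sym[OF kY that] show ?thesis
      by (metis complex_cnj_add)
  qed
  ultimately show ?thesis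
    using psd_kernel_qform[OF kX] psd_kernel_qform[OF kY]
    unfolding psd_mat_iff[OF XY] psd_kernel_def by (metis add_nonneg_nonneg plus_complex.sel(1))
qed

lemma psd_mat_smult:
  assumes X: "X \<in> carrier_mat n n" "psd_mat X" and a: "0 \<le> a"
  shows "psd_mat (complex_of_real a \<cdot>\<^sub>m X)"
proof -
  have aX: "complex_of_real a \<cdot>\<^sub>m X \<in> carrier_mat n n" using X by simp
  note kX = X(2)[unfolded psd_mat_iff[OF X(1)]]
  have "qform n (\<lambda>i j. (complex_of_real a \<cdot>\<^sub>m X) $$ (i, j)) v
      = complex_of_real a * qform n (\<lambda>i j. X $$ (i, j)) v" for v
    unfolding qform_def sum_distrib_left
    by (intro sum.cong refl) (use X in \<open>auto simp: mult_ac\<close>)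
  moreover have "(complex_of_real a \<cdot>\<^sub>m X) $$ (j, i) = cnj ((complex_of_real a \<cdot>\<^sub>m X) $$ (i, j))"
    if "i < n" "j < n" for i j
  proof -
    have "(complex_of_real a \<cdot>\<^sub>m X) $$ (a', b) = complex_of_real a * X $$ (a', b)" if "a' < n" "b < n" for a' b
      using X that by auto
    with that psd_kernel_sym[OF kX that] show ?thesis by simp
  qed
  ultimately show ?thesis
    using psd_kernel_qform[OF kX] a
    unfolding psd_mat_iff[OF aX] psd_kernel_def by (metis mult_nonneg_nonneg Re_complex_of_real Im_complex_of_real
        times_complex.sel(1) mult_zero_left diff_zero)
qed

lemma psd_mat_one: "psd_mat (1\<^sub>m n)"
proof -
  have "qform n (\<lambda>i j. 1\<^sub>m n $$ (i, j)) v = (\<Sum>i<n. v i * cnj (v i))" for v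
    unfolding qform_def
  proof (intro sum.cong refl)
    fix i assume i: "i \<in> {..<n}"
    have "(\<Sum>j<n. 1\<^sub>m n $$ (i, j) * v j * cnj (v i)) = (\<Sum>j<n. if j = i then v i * cnj (v i) else 0)"
      using i by (intro sum.cong) auto
    with i show "(\<Sum>j<n. 1\<^sub>m n $$ (i, j) * v j * cnj (v i)) = v i * cnj (v i)" by simp
  qed
  then show ?thesis
    by (auto simp: psd_mat_iff[OF one_carrier_mat] psd_kernel_def intro!: sum_nonneg add_nonneg_nonneg)
qed

lemma mat_trace_mult:
  assumes "X \<in> carrier_mat n n" "Y \<in> carrier_mat n n"
  shows "mat_trace (X * Y) = (\<Sum>i<n. \<Sum>j<n. X $$ (i, j) * Y $$ (j, i))"
  using assms unfolding mat_trace_def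
  by (auto simp: scalar_prod_def atLeast0LessThan intro!: sum.cong)

lemma psd_mat_trace_mult:
  assumes X: "X \<in> carrier_mat n n" "psd_mat X" and Y: "Y \<in> carrier_mat n n" "psd_mat Y"
  shows "0 \<le> Re (mat_trace (X * Y))" "Im (mat_trace (X * Y)) = 0"
proof -
  note kX = X(2)[unfolded psd_mat_iff[OF X(1)]] and kY = Y(2)[unfolded psd_mat_iff[OF Y(1)]]
  show "0 \<le> Re (mat_trace (X * Y))"
    unfolding mat_trace_mult[OF X(1) Y(1)] by (rule psd_kernel_trace_mult[OF kX kY])
  have "cnj (mat_trace (X * Y)) = (\<Sum>i<n. \<Sum>j<n. X $$ (j, i) * Y $$ (i, j))"
    unfolding mat_trace_mult[OF X(1) Y(1)] cnj_sum complex_cnj_mult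
    by (intro sum.cong refl arg_cong2[of _ _ _ _ "(*)"])
      (auto intro!: psd_kernel_sym[OF kX, symmetric] psd_kernel_sym[OF kY, symmetric])
  also have "\<dots> = mat_trace (X * Y)"
    unfolding mat_trace_mult[OF X(1) Y(1)] by (rule sum.swap)
  finally show "Im (mat_trace (X * Y)) = 0" by (simp add: complex_eq_iff)
qed

lemma mat_trace_mult_minus:
  assumes "X \<in> carrier_mat n n" "Y \<in> carrier_mat n n" "Z \<in> carrier_mat n n"
  shows "mat_trace (X * (Y - Z)) = mat_trace (X * Y) - mat_trace (X * Z)"
  unfolding mat_trace_mult[OF assms(1) minus_carrier_mat[OF assms(3)]] mat_trace_mult[OF assms(1,2)]
    mat_trace_mult[OF assms(1,3)] sum_subtractf[symmetric]
  by (intro sum.cong refl) (use assms in \<open>auto simp: right_diff_distrib\<close>)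

lemma mat_trace_smult:
  "X \<in> carrier_mat n n \<Longrightarrow> mat_trace (a \<cdot>\<^sub>m X) = a * mat_trace X"
  by (auto simp: mat_trace_def sum_distrib_left)

section \<open>Product indices, Kronecker products, partial trace and partial transpose\<close>

lemma sum_prod_index:
  fixes f :: "nat \<Rightarrow> 'a::comm_monoid_add"
  shows "(\<Sum>r<a * b. f r) = (\<Sum>i<a. \<Sum>k<b. f (i * b + k))"
proof -
  have "(\<Sum>k<b. f (i * b + k)) = sum f {i * b..<i * b + b}" for i
    using sum.shift_bounds_nat_ivl[of f 0 "i * b" b] by (simp add: atLeast0LessThan add.commute)
  then show ?thesis by (simp add: sum.nat_group)
qed

lemma prod_index_less: "i < a \<Longrightarrow> k < b \<Longrightarrow> i * b + k < a * (b::nat)"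
proof -
  assume "i < a" "k < b"
  then have "i * b + k < Suc i * b" "Suc i * b \<le> a * b" by (simp, intro mult_le_mono1 Suc_leI)
  then show ?thesis by linarith
qed

lemma div_mod_less:
  assumes "r < a * (b::nat)" shows "r div b < a" "r mod b < b"
  using assms by (auto simp: less_mult_imp_div_less) (metis gr0I mod_less_divisor mult_0_right not_less0)

lemma kron_one_carrier: "S \<in> carrier_mat a a \<Longrightarrow> kron S (1\<^sub>m b) \<in> carrier_mat (a * b) (a * b)"
  unfolding kron_def by auto

lemma kron_one_index:
  assumes "S \<in> carrier_mat a a" "r < a * b" "c < a * b"
  shows "kron S (1\<^sub>m b) $$ (r, c) = (if r mod b = c mod b then S $$ (r div b, c div b) else 0)"
  using assms div_mod_less[OF assms(2)] div_mod_less[OF assms(3)] unfolding kron_def by auto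

lemma kron_smult_left:
  assumes "S \<in> carrier_mat a a"
  shows "kron (x \<cdot>\<^sub>m S) (1\<^sub>m b) = x \<cdot>\<^sub>m kron S (1\<^sub>m b)"
proof (rule eq_matI)
  have xS: "x \<cdot>\<^sub>m S \<in> carrier_mat a a" using assms by simp
  note [simp] = kron_one_carrier[OF assms, of b, THEN carrier_matD(1)]
    kron_one_carrier[OF assms, of b, THEN carrier_matD(2)]
  fix i j assume "i < dim_row (x \<cdot>\<^sub>m kron S (1\<^sub>m b))" "j < dim_col (x \<cdot>\<^sub>m kron S (1\<^sub>m b))"
  then have ij: "i < a * b" "j < a * b" by auto
  then show "kron (x \<cdot>\<^sub>m S) (1\<^sub>m b) $$ (i, j) = (x \<cdot>\<^sub>m kron S (1\<^sub>m b)) $$ (i, j)"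
    using assms div_mod_less[OF ij(1)] div_mod_less[OF ij(2)]
    by (simp add: kron_one_index[OF xS ij] kron_one_index[OF assms ij])
qed (auto simp: kron_def)

lemma kron_one_one: "kron (1\<^sub>m a) (1\<^sub>m b) = 1\<^sub>m (a * b)"
proof (rule eq_matI)
  fix i j assume ij: "i < dim_row (1\<^sub>m (a * b) :: complex mat)" "j < dim_col (1\<^sub>m (a * b) :: complex mat)"
  then have "i < a * b" "j < a * b" by auto
  moreover have "i = j \<longleftrightarrow> i mod b = j mod b \<and> i div b = j div b" by (metis div_mult_mod_eq)
  ultimately show "kron (1\<^sub>m a) (1\<^sub>m b) $$ (i, j) = 1\<^sub>m (a * b) $$ (i, j)"
    using div_mod_less[of i a b] div_mod_less[of j a b]
    by (auto simp: kron_one_index[OF one_carrier_mat])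
qed (auto simp: kron_def)

lemma ptrace_A_smult:
  assumes "X \<in> carrier_mat (a * b) (a * b)"
  shows "ptrace_A a b (x \<cdot>\<^sub>m X) = x \<cdot>\<^sub>m ptrace_A a b X"
  using assms by (intro eq_matI) (auto simp: ptrace_A_def sum_distrib_left prod_index_less)

lemma ptrace_A_one: "ptrace_A a b (1\<^sub>m (a * b)) = complex_of_nat a \<cdot>\<^sub>m 1\<^sub>m b"
  by (intro eq_matI) (auto simp: ptrace_A_def prod_index_less)

lemma ptranspose_B_carrier: "ptranspose_B a b X \<in> carrier_mat (a * b) (a * b)"
  unfolding ptranspose_B_def by simp

lemma ptranspose_B_smult:
  assumes "X \<in> carrier_mat (a * b) (a * b)"
  shows "ptranspose_B a b (x \<cdot>\<^sub>m X) = x \<cdot>\<^sub>m ptranspose_B a b X"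
  using assms by (intro eq_matI) (auto simp: ptranspose_B_def prod_index_less div_mod_less)

lemma ptranspose_B_one: "ptranspose_B a b (1\<^sub>m (a * b)) = 1\<^sub>m (a * b)"
proof (rule eq_matI)
  fix i j assume ij: "i < dim_row (1\<^sub>m (a * b) :: complex mat)" "j < dim_col (1\<^sub>m (a * b) :: complex mat)"
  then have ij: "i < a * b" "j < a * b" by auto
  \<comment> \<open>The partial transpose exchanges the B parts of row and column. Dividing by
    \<open>b\<close> recovers the A parts, so only diagonal positions are moved to diagonal
    positions.\<close>
  have "(i div b * b + j mod b = j div b * b + i mod b) \<longleftrightarrow> i = j"
  proof
    assume eq: "i div b * b + j mod b = j div b * b + i mod b"
    have b: "i mod b < b" "j mod b < b" using div_mod_less ij by auto
    then have "i div b = (i div b * b + j mod b) div b" by simp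
    also have "\<dots> = j div b" using b by (simp add: eq)
    finally show "i = j" using eq by (metis add_left_cancel div_mult_mod_eq)
  qed auto
  with ij show "ptranspose_B a b (1\<^sub>m (a * b)) $$ (i, j) = 1\<^sub>m (a * b) $$ (i, j)"
    by (simp add: ptranspose_B_def prod_index_less div_mod_less)
qed (auto simp: ptranspose_B_def)

section \<open>The Choi matrix of a channel\<close>

lemma unit_mat_carrier: "unit_mat d i j \<in> carrier_mat d d"
  unfolding unit_mat_def by simp

lemma sum_sum_single:
  fixes f :: "nat \<Rightarrow> nat \<Rightarrow> 'a::semiring_1"
  assumes "a < m" "b < n"
  shows "(\<Sum>i<m. \<Sum>j<n. (if a = i \<and> b = j then 1 else 0) * f i j) = f a b"
proof -
  have "(\<Sum>i<m. \<Sum>j<n. (if a = i \<and> b = j then 1 else 0) * f i j)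
      = (\<Sum>i<m. if i = a then f a b else 0)"
  proof (intro sum.cong refl)
    fix i
    have "(\<Sum>j<n. (if a = i \<and> b = j then 1 else 0) * f i j)
        = (\<Sum>j<n. if j = b then (if i = a then f a b else 0) else 0)"
      by (intro sum.cong) auto
    with assms show "(\<Sum>j<n. (if a = i \<and> b = j then 1 else 0) * f i j) = (if i = a then f a b else 0)"
      by simp
  qed
  with assms show ?thesis by simp
qed

lemma choi_mat_carrier: "choi_mat dA dB N \<in> carrier_mat (dA * dB) (dA * dB)"
  unfolding choi_mat_def by simp

lemma kron_unit_mat_index:
  assumes "Y \<in> carrier_mat e e" "r < d * e" "c < d * e"
  shows "kron (unit_mat d i j) Y $$ (r, c)
     = (if r div e = i \<and> c div e = j then 1 else 0) * Y $$ (r mod e, c mod e)"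
  using assms div_mod_less[OF assms(2)] div_mod_less[OF assms(3)]
  unfolding kron_def unit_mat_def by auto

lemma choi_mat_index:
  assumes N: "linear_superop dA dB N" and rc: "r < dA * dB" "c < dA * dB"
  shows "choi_mat dA dB N $$ (r, c) = N (unit_mat dA (r div dB) (c div dB)) $$ (r mod dB, c mod dB)"
proof -
  have NE: "N (unit_mat dA i j) \<in> carrier_mat dB dB" for i j
    using N unit_mat_carrier unfolding linear_superop_def by blast
  have "choi_mat dA dB N $$ (r, c) = (\<Sum>i<dA. \<Sum>j<dA. (if r div dB = i \<and> c div dB = j then 1 else 0)
      * N (unit_mat dA i j) $$ (r mod dB, c mod dB))"
    using rc by (simp add: choi_mat_def kron_unit_mat_index[OF NE rc])
  also have "\<dots> = N (unit_mat dA (r div dB) (c div dB)) $$ (r mod dB, c mod dB)"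
    using rc by (intro sum_sum_single) (auto simp: div_mod_less)
  finally show ?thesis .
qed

text \<open>The Choi matrix is the image of the unnormalised maximally entangled state
  \<open>\<Omega> = \<Sum>\<^sub>i\<^sub>j E\<^sub>i\<^sub>j \<otimes> E\<^sub>i\<^sub>j\<close>.\<close>

lemma psd_choi_mat:
  assumes N: "quantum_channel dA dB N"
  shows "psd_mat (choi_mat dA dB N)"
proof -
  \<comment> \<open>The vector \<open>u\<close> is the sum of |ii> over the basis of two copies of
    A, and \<open>X\<close> is its rank one operator.\<close>
  define u where "u r = (if r div dA = r mod dA then 1 else 0 :: complex)" for r
  define X where "X = mat (dA * dA) (dA * dA) (\<lambda>(r, c). u r * u c)"
  have X: "X \<in> carrier_mat (dA * dA) (dA * dA)" by (simp add: X_def)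
  have u_cnj: "cnj (u r) = u r" for r by (simp add: u_def)
  have "psd_mat X"
    unfolding psd_mat_iff[OF X] psd_kernel_def
  proof (intro conjI allI impI)
    fix v
    have "qform (dA * dA) (\<lambda>i j. X $$ (i, j)) v = (\<Sum>i<dA * dA. \<Sum>j<dA * dA. (u i * cnj (v i)) * (u j * v j))"
      unfolding qform_def by (intro sum.cong refl) (auto simp: X_def)
    also have "\<dots> = cnj (\<Sum>i<dA * dA. u i * v i) * (\<Sum>i<dA * dA. u i * v i)"
      unfolding sum_product cnj_sum complex_cnj_mult u_cnj by simp
    also have "\<dots> = complex_of_real ((cmod (\<Sum>i<dA * dA. u i * v i))\<^sup>2)"
      by (simp only: complex_norm_square mult.commute)
    finally show "0 \<le> Re (qform (dA * dA) (\<lambda>i j. X $$ (i, j)) v)" by (simp del: of_real_power)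
  qed (auto simp: X_def u_cnj)
  \<comment> \<open>Complete positivity is applied with a reference system of dimension
    \<open>dA\<close>.\<close>
  then have "psd_mat (tensor_superop dA dA dA dB (\<lambda>Y. Y) N X)"
    using N X by (simp add: quantum_channel_def completely_positive_def)
  also have "tensor_superop dA dA dA dB (\<lambda>Y. Y) N X = choi_mat dA dB N"
  proof -
    \<comment> \<open>These coefficients force \<open>k = i\<close> and \<open>l = j\<close>, which
      reduces the fourfold sum to the double sum of the Choi matrix.\<close>
    have "X $$ (i * dA + k, j * dA + l) = (if i = k \<and> j = l then 1 else 0)"
      if "i < dA" "j < dA" "k < dA" "l < dA" for i j k l
      using that by (simp add: X_def u_def prod_index_less)
    then have "(\<Sum>k<dA. \<Sum>l<dA. X $$ (i * dA + k, j * dA + l) * kron (unit_mat dA i j) (N (unit_mat dA k l)) $$ (r, c))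
       = kron (unit_mat dA i j) (N (unit_mat dA i j)) $$ (r, c)" if "i < dA" "j < dA" for i j r c
      using that sum_sum_single[of i dA j dA "\<lambda>k l. kron (unit_mat dA i j) (N (unit_mat dA k l)) $$ (r, c)"] by simp
    then show ?thesis
      unfolding tensor_superop_def choi_mat_def by (intro cong_mat refl) simp
  qed
  finally show ?thesis .
qed

text \<open>The identity on B sums over the output diagonal, so the image of each matrix unit enters
  only through its trace, which is 1 for \<open>i = j\<close> and 0 otherwise. The diagonal of
  \<open>S\<close> remains.\<close>

lemma choi_mat_kron_trace:
  assumes N: "quantum_channel dA dB N" and S: "S \<in> carrier_mat dA dA"
  shows "mat_trace (choi_mat dA dB N * kron S (1\<^sub>m dB)) = mat_trace S"
proof -
  have lin: "linear_superop dA dB N" using N by (simp add: quantum_channel_def)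
  have trN: "(\<Sum>k<dB. N (unit_mat dA i j) $$ (k, k)) = (if i = j then 1 else 0)" if "i < dA" "j < dA" for i j
  proof -
    have "N (unit_mat dA i j) \<in> carrier_mat dB dB"
      using lin unit_mat_carrier unfolding linear_superop_def by blast
    then have "(\<Sum>k<dB. N (unit_mat dA i j) $$ (k, k)) = mat_trace (N (unit_mat dA i j))"
      by (auto simp: mat_trace_def)
    also have "\<dots> = mat_trace (unit_mat dA i j)"
      using N unit_mat_carrier unfolding quantum_channel_def by blast
    also have "\<dots> = (\<Sum>a<dA. if a = i then (if i = j then 1 else 0) else 0)"
      by (auto simp: mat_trace_def unit_mat_def intro!: sum.cong)
    finally show ?thesis using that by simp
  qed
  have "mat_trace (choi_mat dA dB N * kron S (1\<^sub>m dB))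
     = (\<Sum>i<dA. \<Sum>k<dB. \<Sum>j<dA. \<Sum>l<dB. (if l = k then N (unit_mat dA i j) $$ (k, k) * S $$ (j, i) else 0))"
    unfolding mat_trace_mult[OF choi_mat_carrier kron_one_carrier[OF S]] sum_prod_index
    by (intro sum.cong refl) (simp add: choi_mat_index[OF lin] kron_one_index[OF S] prod_index_less)
  also have "\<dots> = (\<Sum>i<dA. \<Sum>k<dB. \<Sum>j<dA. N (unit_mat dA i j) $$ (k, k) * S $$ (j, i))"
    by (intro sum.cong refl) simp
  also have "\<dots> = (\<Sum>i<dA. \<Sum>j<dA. (\<Sum>k<dB. N (unit_mat dA i j) $$ (k, k)) * S $$ (j, i))"
    unfolding sum_distrib_right by (intro sum.cong refl sum.swap)
  also have "\<dots> = (\<Sum>i<dA. \<Sum>j<dA. if j = i then S $$ (i, i) else 0)"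
    by (intro sum.cong refl) (auto simp: trN)
  also have "\<dots> = mat_trace S" using S by (auto simp: mat_trace_def)
  finally show ?thesis .
qed

section \<open>Feasible pairs\<close>

text \<open>The constraints of the success probability (\<open>t = 1 / \<lambda>\<close>) and those of the zero-error program
  (\<open>t = 1\<close>) are this homogeneous system.\<close>

definition feasible :: "assistance \<Rightarrow> nat \<Rightarrow> nat \<Rightarrow> real \<Rightarrow> complex mat \<Rightarrow> complex mat \<Rightarrow> bool" where
  "feasible \<Omega> a b t S U \<longleftrightarrow> S \<in> carrier_mat a a \<and> U \<in> carrier_mat (a * b) (a * b) \<and>
     psd_mat U \<and> psd_mat (kron S (1\<^sub>m b) - U) \<and> ptrace_A a b U = complex_of_real t \<cdot>\<^sub>m 1\<^sub>m b \<and>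
     (\<Omega> = NS_PPT \<longrightarrow> psd_mat (ptranspose_B a b U) \<and> psd_mat (kron S (1\<^sub>m b) - ptranspose_B a b U))"

lemma loewner_le_zero_iff: "X \<in> carrier_mat n n \<Longrightarrow> 0\<^sub>m n n \<le>\<^sub>L X \<longleftrightarrow> psd_mat X"
proof -
  assume X: "X \<in> carrier_mat n n"
  then have "X - 0\<^sub>m n n = X" by (intro eq_matI) auto
  with X show ?thesis by (auto simp: loewner_le_def)
qed

lemma loewner_le_iff:
  "X \<in> carrier_mat n n \<Longrightarrow> Y \<in> carrier_mat n n \<Longrightarrow> X \<le>\<^sub>L Y \<longleftrightarrow> psd_mat (Y - X)"
  by (auto simp: loewner_le_def)

lemma feasible_iff_loewner:
  "feasible \<Omega> a b t S U \<longleftrightarrow>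
     S \<in> carrier_mat a a \<and> U \<in> carrier_mat (a * b) (a * b) \<and>
     0\<^sub>m (a * b) (a * b) \<le>\<^sub>L U \<and> U \<le>\<^sub>L kron S (1\<^sub>m b) \<and>
     ptrace_A a b U = complex_of_real t \<cdot>\<^sub>m 1\<^sub>m b \<and>
     (\<Omega> = NS_PPT \<longrightarrow> 0\<^sub>m (a * b) (a * b) \<le>\<^sub>L ptranspose_B a b U \<and> ptranspose_B a b U \<le>\<^sub>L kron S (1\<^sub>m b))"
  unfolding feasible_def
  using loewner_le_zero_iff[of U "a * b"] loewner_le_zero_iff[OF ptranspose_B_carrier, of a b U]
    loewner_le_iff[of U "a * b"] loewner_le_iff[OF ptranspose_B_carrier, of _ a b U] kron_one_carrier[of S a b]
  by blast

text \<open>All constraints are homogeneous in the pair and \<open>t\<close>. The factors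
  \<open>l\<close> and \<open>1 / l\<close> later pass between codes for \<open>l\<close> messages
  and pairs with \<open>t = 1\<close>.\<close>

lemma feasible_scale:
  assumes F: "feasible \<Omega> a b t S U" and x: "0 \<le> x"
  shows "feasible \<Omega> a b (x * t) (complex_of_real x \<cdot>\<^sub>m S) (complex_of_real x \<cdot>\<^sub>m U)"
proof -
  have S: "S \<in> carrier_mat a a" and U: "U \<in> carrier_mat (a * b) (a * b)"
    using F by (auto simp: feasible_def)
  note K = kron_one_carrier[OF S, of b]
  have diff: "complex_of_real x \<cdot>\<^sub>m kron S (1\<^sub>m b) - complex_of_real x \<cdot>\<^sub>m Y
      = complex_of_real x \<cdot>\<^sub>m (kron S (1\<^sub>m b) - Y)" if "Y \<in> carrier_mat (a * b) (a * b)" for Y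
    using K that by (intro eq_matI) (auto simp: right_diff_distrib)
  have psd: "psd_mat (complex_of_real x \<cdot>\<^sub>m (kron S (1\<^sub>m b) - Y))"
    if "Y \<in> carrier_mat (a * b) (a * b)" "psd_mat (kron S (1\<^sub>m b) - Y)" for Y
    using psd_mat_smult[OF minus_carrier_mat[OF that(1)] that(2) x] .
  have one: "complex_of_real x \<cdot>\<^sub>m (complex_of_real t \<cdot>\<^sub>m 1\<^sub>m b) = complex_of_real (x * t) \<cdot>\<^sub>m 1\<^sub>m b"
    by (intro eq_matI) auto
  show ?thesis
    using F S U psd[OF U] psd[OF ptranspose_B_carrier, of U] psd_mat_smult[OF U _ x]
      psd_mat_smult[OF ptranspose_B_carrier _ x, of a b U]
    unfolding feasible_def kron_smult_left[OF S] ptranspose_B_smult[OF U] ptrace_A_smult[OF U]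
      diff[OF U] diff[OF ptranspose_B_carrier]
    by (auto simp: one)
qed

text \<open>The maximally mixed state scaled to trace \<open>l\<close>, with \<open>U\<close> a
  multiple of the identity, makes both maximisations nonempty; at \<open>l = 1\<close> the slack
  vanishes, as the zero-error program requires.\<close>

lemma feasible_exists:
  assumes "0 < a" "1 \<le> l"
  obtains S U where "feasible \<Omega> a b 1 S U" "mat_trace S = complex_of_real l"
    "l = 1 \<Longrightarrow> kron S (1\<^sub>m b) - U = 0\<^sub>m (a * b) (a * b)"
proof -
  define S where "S = complex_of_real (l / real a) \<cdot>\<^sub>m 1\<^sub>m a"
  define U where "U = complex_of_real (1 / real a) \<cdot>\<^sub>m 1\<^sub>m (a * b)"
  have K: "kron S (1\<^sub>m b) = complex_of_real (l / real a) \<cdot>\<^sub>m 1\<^sub>m (a * b)"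
    unfolding S_def kron_smult_left[OF one_carrier_mat] kron_one_one ..
  \<comment> \<open>The partial transpose fixes the identity, so the PPT constraints reduce to the
    other two.\<close>
  have T: "ptranspose_B a b U = U"
    unfolding U_def ptranspose_B_smult[OF one_carrier_mat] ptranspose_B_one ..
  have D: "kron S (1\<^sub>m b) - U = complex_of_real ((l - 1) / real a) \<cdot>\<^sub>m 1\<^sub>m (a * b)"
    unfolding K U_def by (intro eq_matI) (auto simp: diff_divide_distrib)
  have "psd_mat U" unfolding U_def by (intro psd_mat_smult[OF one_carrier_mat psd_mat_one]) simp
  moreover have "psd_mat (kron S (1\<^sub>m b) - U)"
    unfolding D by (intro psd_mat_smult[OF one_carrier_mat psd_mat_one]) (use assms in simp)
  moreover have "ptrace_A a b U = complex_of_real 1 \<cdot>\<^sub>m 1\<^sub>m b"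
    unfolding U_def ptrace_A_smult[OF one_carrier_mat] ptrace_A_one
    using assms by (intro eq_matI) auto
  moreover have "S \<in> carrier_mat a a" "U \<in> carrier_mat (a * b) (a * b)" by (auto simp: S_def U_def)
  ultimately have "feasible \<Omega> a b 1 S U" unfolding feasible_def T by blast
  moreover have "mat_trace S = complex_of_real l"
    using assms by (simp add: S_def mat_trace_def)
  moreover have "kron S (1\<^sub>m b) - U = 0\<^sub>m (a * b) (a * b)" if "l = 1"
    unfolding D using that by (intro eq_matI) auto
  ultimately show ?thesis by (rule that)
qed

text \<open>The sum of the slack and \<open>U\<close>, both positive. Hermiticity and the diagonal
  signs of \<open>S\<close> are read off from this.\<close>

lemma feasible_kron_psd:
  assumes "feasible \<Omega> a b t S U"
  shows "psd_mat (kron S (1\<^sub>m b))"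
proof -
  have S: "S \<in> carrier_mat a a" and U: "U \<in> carrier_mat (a * b) (a * b)"
    using assms by (auto simp: feasible_def)
  have "psd_mat ((kron S (1\<^sub>m b) - U) + U)"
    using assms by (intro psd_mat_add[OF minus_carrier_mat[OF U] _ U]) (auto simp: feasible_def)
  also have "(kron S (1\<^sub>m b) - U) + U = kron S (1\<^sub>m b)"
    using U kron_one_carrier[OF S, of b] by (intro eq_matI) auto
  finally show ?thesis .
qed

section \<open>Bounds for feasible pairs with \<open>t = 1\<close>\<close>

context
  fixes \<Omega> a b S U
  assumes F: "feasible \<Omega> a b 1 S U" and b: "0 < b"
begin

lemma feasible_carriers:
  "S \<in> carrier_mat a a" "U \<in> carrier_mat (a * b) (a * b)"
  using F by (auto simp: feasible_def)

lemma feasible_kernels: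
  "psd_kernel (a * b) (\<lambda>r c. kron S (1\<^sub>m b) $$ (r, c))"
  "psd_kernel (a * b) (\<lambda>r c. U $$ (r, c))"
  "psd_kernel (a * b) (\<lambda>r c. (kron S (1\<^sub>m b) - U) $$ (r, c))"
  using feasible_kron_psd[OF F] F feasible_carriers
  unfolding feasible_def psd_mat_iff[OF kron_one_carrier[OF feasible_carriers(1)]]
    psd_mat_iff[OF feasible_carriers(2)] psd_mat_iff[OF minus_carrier_mat[OF feasible_carriers(2)]]
  by blast+

text \<open>The indices \<open>i * b\<close> have B part 0, which exists as \<open>b\<close> is
  positive; they exhibit \<open>S\<close> as a principal submatrix of S tensor 1.\<close>

lemma kron_one_entry: "i < a \<Longrightarrow> j < a \<Longrightarrow> kron S (1\<^sub>m b) $$ (i * b, j * b) = S $$ (i, j)"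
  using kron_one_index[OF feasible_carriers(1), of "i * b" b "j * b"] prod_index_less[of i a 0 b]
    prod_index_less[of j a 0 b] b by simp

lemma feasible_sym: "i < a \<Longrightarrow> j < a \<Longrightarrow> S $$ (j, i) = cnj (S $$ (i, j))"
  using psd_kernel_sym[OF feasible_kernels(1), of "i * b" "j * b"] kron_one_entry[of i j] kron_one_entry[of j i]
    prod_index_less[of i a 0 b] prod_index_less[of j a 0 b] b by simp

lemma feasible_diag: "i < a \<Longrightarrow> 0 \<le> Re (S $$ (i, i))" "i < a \<Longrightarrow> Im (S $$ (i, i)) = 0"
  using psd_kernel_diag[OF feasible_kernels(1), of "i * b"] kron_one_entry[of i i]
    prod_index_less[of i a 0 b] b by simp_all

lemma feasible_hermitian: "hermitian_mat S"
  unfolding hermitian_mat_iff[OF feasible_carriers(1)] by (intro allI impI feasible_sym)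

lemma feasible_trace_real: "mat_trace S = complex_of_real (Re (mat_trace S))"
  using feasible_diag(2) feasible_carriers by (auto simp: complex_eq_iff mat_trace_def)

lemma feasible_ptrace: "k < b \<Longrightarrow> (\<Sum>i<a. U $$ (i * b + k, i * b + k)) = 1"
proof -
  assume k: "k < b"
  have "ptrace_A a b U = complex_of_real 1 \<cdot>\<^sub>m 1\<^sub>m b" using F by (simp add: feasible_def)
  then have "ptrace_A a b U $$ (k, k) = (complex_of_real 1 \<cdot>\<^sub>m 1\<^sub>m b) $$ (k, k)" by simp
  with k show ?thesis by (simp add: ptrace_A_def)
qed

text \<open>Compare the diagonals of \<open>U\<close> and S tensor 1 at B part 0: the first sums to
  1 by the partial trace constraint, the second to the trace of \<open>S\<close>.\<close>

lemma feasible_trace_ge_one: "1 \<le> Re (mat_trace S)"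
proof -
  have "Re (U $$ (i * b, i * b)) \<le> Re (S $$ (i, i))" if "i < a" for i
    using psd_kernel_diag(1)[OF feasible_kernels(3), of "i * b"] kron_one_entry[of i i] that
      prod_index_less[of i a 0 b] b kron_one_carrier[OF feasible_carriers(1), of b] feasible_carriers(2)
    by simp
  then have "(\<Sum>i<a. Re (U $$ (i * b, i * b))) \<le> (\<Sum>i<a. Re (S $$ (i, i)))"
    by (intro sum_mono) simp
  also have "(\<Sum>i<a. Re (U $$ (i * b, i * b))) = 1"
    using arg_cong[OF feasible_ptrace[OF b], of Re] by simp
  finally show ?thesis using feasible_carriers by (simp add: mat_trace_def)
qed

text \<open>Nonnegative diagonal entries are each at most the trace, and
  \<open>psd_kernel_entry_le\<close> extends the bound to all entries.\<close>

lemma feasible_entry_left_le: "i < a \<Longrightarrow> j < a \<Longrightarrow> cmod (S $$ (i, j)) \<le> Re (mat_trace S)"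
proof -
  assume ij: "i < a" "j < a"
  have le: "Re (S $$ (k, k)) \<le> Re (mat_trace S)" if "k < a" for k
    using feasible_carriers that feasible_diag(1)
      member_le_sum[of k "{..<a}" "\<lambda>k. Re (S $$ (k, k))"] by (auto simp: mat_trace_def)
  show ?thesis
    using psd_kernel_entry_le[OF feasible_kernels(1), of "i * b" "j * b" "Re (mat_trace S)"]
      le[OF ij(1)] le[OF ij(2)] kron_one_entry[OF ij] kron_one_entry[of i i] kron_one_entry[of j j] ij
      prod_index_less[of i a 0 b] prod_index_less[of j a 0 b] b by simp
qed

text \<open>Each diagonal entry of \<open>U\<close> is one nonnegative summand of a partial trace
  entry equal to 1.\<close>

lemma feasible_entry_right_le: "r < a * b \<Longrightarrow> c < a * b \<Longrightarrow> cmod (U $$ (r, c)) \<le> 1"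
proof -
  assume rc: "r < a * b" "c < a * b"
  have le: "Re (U $$ (r, r)) \<le> 1" if r: "r < a * b" for r
  proof -
    have "Re (U $$ (r, r)) = Re (U $$ (r div b * b + r mod b, r div b * b + r mod b))" by simp
    also have "\<dots> \<le> (\<Sum>i<a. Re (U $$ (i * b + r mod b, i * b + r mod b)))"
      using div_mod_less[OF r] psd_kernel_diag(1)[OF feasible_kernels(2)] prod_index_less
      by (intro member_le_sum[of "r div b" "{..<a}" "\<lambda>i. Re (U $$ (i * b + r mod b, i * b + r mod b))"]) auto
    also have "\<dots> = 1"
      using arg_cong[OF feasible_ptrace[of "r mod b"], of Re] b by simp
    finally show ?thesis .
  qed
  show ?thesis
    using psd_kernel_entry_le[OF feasible_kernels(2) rc le[OF rc(1)] le[OF rc(2)]] .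
qed

text \<open>By \<open>choi_mat_kron_trace\<close> the trace of \<open>J\<close> against the slack is
  Tr S - Tr J U. It is real and nonnegative, so it vanishes exactly when the real parts
  agree.\<close>

lemma feasible_choi_le:
  assumes N: "quantum_channel a b N"
  shows "Re (mat_trace (choi_mat a b N * U)) \<le> Re (mat_trace S)"
    "mat_trace (choi_mat a b N * (kron S (1\<^sub>m b) - U)) = 0
       \<longleftrightarrow> Re (mat_trace (choi_mat a b N * U)) = Re (mat_trace S)"
proof -
  let ?D = "mat_trace (choi_mat a b N * (kron S (1\<^sub>m b) - U))"
  have "?D = mat_trace S - mat_trace (choi_mat a b N * U)"
    using mat_trace_mult_minus[OF choi_mat_carrier kron_one_carrier[OF feasible_carriers(1)] feasible_carriers(2)]
      choi_mat_kron_trace[OF N feasible_carriers(1)] by simp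
  moreover have "0 \<le> Re ?D" "Im ?D = 0"
    using F by (intro psd_mat_trace_mult[OF choi_mat_carrier psd_choi_mat[OF N]
          minus_carrier_mat[OF feasible_carriers(2)]]; simp add: feasible_def)+
  ultimately show "Re (mat_trace (choi_mat a b N * U)) \<le> Re (mat_trace S)"
    "?D = 0 \<longleftrightarrow> Re (mat_trace (choi_mat a b N * U)) = Re (mat_trace S)"
    by (auto simp: complex_eq_iff)
qed

text \<open>The bound depends on the channel alone. It controls the trace of \<open>S\<close> in the
  zero-error program, where that trace is not fixed.\<close>

lemma feasible_choi_bound:
  "Re (mat_trace (choi_mat a b N * U)) \<le> (\<Sum>i<a * b. \<Sum>j<a * b. cmod (choi_mat a b N $$ (i, j)))"
proof -
  have "Re (mat_trace (choi_mat a b N * U)) \<le> cmod (mat_trace (choi_mat a b N * U))"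
    by (rule complex_Re_le_cmod)
  also have "\<dots> \<le> (\<Sum>i<a * b. \<Sum>j<a * b. cmod (choi_mat a b N $$ (i, j)))"
    unfolding mat_trace_mult[OF choi_mat_carrier feasible_carriers(2)]
    by (intro sum_norm_le) (auto simp: norm_mult intro!: mult_left_le feasible_entry_right_le)
  finally show ?thesis .
qed

end

section \<open>Attainment of the optima\<close>

text \<open>Continuity is entrywise for a family of fixed shape over a parameter space, so no
  topology on the type of matrices of all sizes is involved.\<close>

definition continuous_mat :: "nat \<Rightarrow> nat \<Rightarrow> ('p::topological_space \<Rightarrow> complex mat) \<Rightarrow> bool" where
  "continuous_mat n m M \<longleftrightarrow> (\<forall>p. M p \<in> carrier_mat n m) \<and>
     (\<forall>i<n. \<forall>j<m. continuous_on UNIV (\<lambda>p. M p $$ (i, j)))"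

lemma continuous_mat_carrier: "continuous_mat n m M \<Longrightarrow> M p \<in> carrier_mat n m"
  unfolding continuous_mat_def by blast

lemma continuous_mat_entry:
  "continuous_mat n m M \<Longrightarrow> i < n \<Longrightarrow> j < m \<Longrightarrow> continuous_on UNIV (\<lambda>p. M p $$ (i, j))"
  unfolding continuous_mat_def by blast

lemma continuous_mat_const: "X \<in> carrier_mat n m \<Longrightarrow> continuous_mat n m (\<lambda>_. X)"
  unfolding continuous_mat_def by simp

lemma continuous_mat_minus:
  assumes X: "continuous_mat n m X" and Y: "continuous_mat n m Y"
  shows "continuous_mat n m (\<lambda>p. X p - Y p)"
  unfolding continuous_mat_def
proof (intro conjI allI impI)
  note c = continuous_mat_carrier[OF X] continuous_mat_carrier[OF Y]
  show "X p - Y p \<in> carrier_mat n m" for p by (rule minus_carrier_mat[OF c(2)])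
  fix i j assume ij: "i < n" "j < m"
  have "(X p - Y p) $$ (i, j) = X p $$ (i, j) - Y p $$ (i, j)" for p
    using c[of p] ij by simp
  then show "continuous_on UNIV (\<lambda>p. (X p - Y p) $$ (i, j))"
    using continuous_mat_entry[OF X ij] continuous_mat_entry[OF Y ij] by (simp add: continuous_on_diff)
qed

lemma continuous_mat_kron_one:
  assumes X: "continuous_mat a a X"
  shows "continuous_mat (a * b) (a * b) (\<lambda>p. kron (X p) (1\<^sub>m b))"
  unfolding continuous_mat_def
proof (intro conjI allI impI)
  note c = continuous_mat_carrier[OF X]
  show "kron (X p) (1\<^sub>m b) \<in> carrier_mat (a * b) (a * b)" for p using kron_one_carrier[OF c] .
  fix r c assume rc: "r < a * b" "c < a * b"
  show "continuous_on UNIV (\<lambda>p. kron (X p) (1\<^sub>m b) $$ (r, c))"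
    unfolding kron_one_index[OF continuous_mat_carrier[OF X] rc]
    using continuous_mat_entry[OF X] rc by (cases "r mod b = c mod b") (auto simp: div_mod_less)
qed

lemma continuous_mat_ptrace_A:
  assumes X: "continuous_mat (a * b) (a * b) X"
  shows "continuous_mat b b (\<lambda>p. ptrace_A a b (X p))"
  unfolding continuous_mat_def
  by (auto simp: ptrace_A_def prod_index_less intro!: continuous_on_sum continuous_mat_entry[OF X])

lemma continuous_mat_ptranspose_B:
  assumes X: "continuous_mat (a * b) (a * b) X"
  shows "continuous_mat (a * b) (a * b) (\<lambda>p. ptranspose_B a b (X p))"
  unfolding continuous_mat_def
  by (auto simp: ptranspose_B_def prod_index_less div_mod_less intro!: continuous_mat_entry[OF X])

lemma continuous_on_mat_trace:
  assumes X: "continuous_mat n n X"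
  shows "continuous_on UNIV (\<lambda>p. mat_trace (X p))"
proof -
  have "mat_trace (X p) = (\<Sum>i<n. X p $$ (i, i))" for p
    using continuous_mat_carrier[OF X, of p] by (auto simp: mat_trace_def)
  then show ?thesis by (auto intro!: continuous_on_sum continuous_mat_entry[OF X])
qed

lemma continuous_on_mat_trace_mult:
  assumes X: "continuous_mat n n X" and Y: "continuous_mat n n Y"
  shows "continuous_on UNIV (\<lambda>p. mat_trace (X p * Y p))"
  unfolding mat_trace_mult[OF continuous_mat_carrier[OF X] continuous_mat_carrier[OF Y]]
  by (auto intro!: continuous_on_sum continuous_on_mult continuous_mat_entry[OF X] continuous_mat_entry[OF Y])

lemma closed_Collect_less_imp:
  "(i < n \<Longrightarrow> closed {p. P p}) \<Longrightarrow> closed {p. i < (n::nat) \<longrightarrow> P p}"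
  by (cases "i < n") auto

lemma closed_mat_eq:
  assumes X: "continuous_mat n m X" and C: "C \<in> carrier_mat n m"
  shows "closed {p. X p = C}"
proof -
  have "X p = C \<longleftrightarrow> (\<forall>i<n. \<forall>j<m. X p $$ (i, j) = C $$ (i, j))" for p
    using continuous_mat_carrier[OF X, of p] C by auto
  then show ?thesis
    by (simp only:) (intro closed_Collect_all closed_Collect_less_imp closed_Collect_eq
        continuous_mat_entry[OF X] continuous_on_const)
qed

text \<open>An intersection of closed conditions: the equations of Hermitian symmetry and one weak
  inequality for each \<open>v\<close>.\<close>

lemma closed_psd_mat:
  assumes X: "continuous_mat n n X"
  shows "closed {p. psd_mat (X p)}"
  unfolding psd_mat_iff[OF continuous_mat_carrier[OF X]] psd_kernel_def qform_def
  by (intro closed_Collect_conj closed_Collect_all closed_Collect_less_imp closed_Collect_eq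
      closed_Collect_le continuous_on_const continuous_on_Re continuous_on_sum continuous_on_mult
      continuous_on_cnj continuous_mat_entry[OF X]) auto

lemma closed_feasible:
  assumes S: "continuous_mat a a S" and U: "continuous_mat (a * b) (a * b) U"
  shows "closed {p. feasible \<Omega> a b t (S p) (U p)}"
  unfolding feasible_def
  by (intro closed_Collect_conj closed_Collect_imp open_Collect_const closed_psd_mat[of "a * b"] closed_mat_eq[of b b]
      continuous_mat_minus continuous_mat_kron_one continuous_mat_ptrace_A continuous_mat_ptranspose_B S U)
    (simp_all add: continuous_mat_carrier[OF S] continuous_mat_carrier[OF U])

text \<open>Tychonoff's theorem for a product of closed discs.\<close>

lemma compact_bounded_functions: "compact {f :: 'i \<Rightarrow> complex. \<forall>k. cmod (f k) \<le> d}"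
proof -
  have "compactin (product_topology (\<lambda>_. euclidean) UNIV) (PiE (UNIV :: 'i set) (\<lambda>_. cball (0 :: complex) d))"
    unfolding compactin_PiE by simp
  moreover have "PiE (UNIV :: 'i set) (\<lambda>_. cball (0 :: complex) d) = {f. \<forall>k. cmod (f k) \<le> d}"
    by (auto simp: PiE_def Pi_def)
  ultimately show ?thesis by (simp add: euclidean_product_topology)
qed

text \<open>A pair of such functions lists candidate entries of \<open>S\<close> and
  \<open>U\<close>; \<open>mat\<close> imposes the shapes and ignores all other values.\<close>

type_synonym entries = "nat \<times> nat \<Rightarrow> complex"

lemma continuous_mat_fst: "continuous_mat n m (\<lambda>p :: entries \<times> entries. mat n m (fst p))"
  unfolding continuous_mat_def
  by (auto intro!: continuous_on_product_then_coordinatewise continuous_on_fst continuous_on_id)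

lemma continuous_mat_snd: "continuous_mat n m (\<lambda>p :: entries \<times> entries. mat n m (snd p))"
  unfolding continuous_mat_def
  by (auto intro!: continuous_on_product_then_coordinatewise continuous_on_snd continuous_on_id)

text \<open>The extreme value theorem for both programs: \<open>P\<close> is the extra closed
  constraint and \<open>h\<close> the objective. The bound \<open>c\<close> on the trace bounds the
  entries of \<open>S\<close>, while those of \<open>U\<close> are bounded by 1.\<close>

lemma feasible_attains_sup:
  fixes a b :: nat and h :: "complex mat \<Rightarrow> complex mat \<Rightarrow> real"
  defines "S \<equiv> \<lambda>p :: entries \<times> entries. mat a a (fst p)"
    and "U \<equiv> \<lambda>p :: entries \<times> entries. mat (a * b) (a * b) (snd p)"
  assumes b: "0 < b"
    and P: "closed {p. P (S p) (U p)}" and h: "continuous_on UNIV (\<lambda>p. h (S p) (U p))"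
    and ex: "feasible \<Omega> a b 1 S\<^sub>0 U\<^sub>0" "P S\<^sub>0 U\<^sub>0"
    and bound: "\<And>S U. feasible \<Omega> a b 1 S U \<Longrightarrow> P S U \<Longrightarrow> Re (mat_trace S) \<le> c"
  obtains S U where "feasible \<Omega> a b 1 S U" "P S U"
    "\<And>S' U'. feasible \<Omega> a b 1 S' U' \<Longrightarrow> P S' U' \<Longrightarrow> h S' U' \<le> h S U"
proof -
  define B where "B = {f :: entries. \<forall>k. cmod (f k) \<le> max c 1}"
  define K where "K = (B \<times> B) \<inter> ({p. feasible \<Omega> a b 1 (S p) (U p)} \<inter> {p. P (S p) (U p)})"
  have "continuous_mat a a S" "continuous_mat (a * b) (a * b) U"
    unfolding S_def U_def by (rule continuous_mat_fst continuous_mat_snd)+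
  then have "compact K"
    unfolding K_def B_def
    by (intro compact_Int_closed compact_Times compact_bounded_functions closed_Int closed_feasible P)
  have rep: "\<exists>p \<in> K. S p = S' \<and> U p = U'" if F: "feasible \<Omega> a b 1 S' U'" and "P S' U'" for S' U'
  proof -
    \<comment> \<open>Zeros outside the shapes keep every coordinate within \<open>max c 1\<close>,
      which is positive whatever \<open>c\<close> is.\<close>
    define p where "p = (\<lambda>(i, j). if i < a \<and> j < a then S' $$ (i, j) else 0,
      \<lambda>(i, j). if i < a * b \<and> j < a * b then U' $$ (i, j) else 0)"
    have S: "S p = S'" and U: "U p = U'"
      using feasible_carriers[OF F b] by (auto simp: S_def U_def p_def)
    have "cmod (S' $$ (i, j)) \<le> max c 1" if "i < a" "j < a" for i j
      using feasible_entry_left_le[OF F b that] bound[OF F \<open>P S' U'\<close>] by linarith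
    moreover have "cmod (U' $$ (i, j)) \<le> max c 1" if "i < a * b" "j < a * b" for i j
      using feasible_entry_right_le[OF F b that] by linarith
    ultimately have "p \<in> B \<times> B" by (auto simp: p_def B_def le_max_iff_disj)
    with S U that show ?thesis unfolding K_def by blast
  qed
  then have "K \<noteq> {}" using ex by blast
  from continuous_attains_sup[OF \<open>compact K\<close> this continuous_on_subset[OF h]]
  obtain p where p: "p \<in> K" and sup: "\<And>q. q \<in> K \<Longrightarrow> h (S q) (U q) \<le> h (S p) (U p)" by auto
  show ?thesis
  proof (rule that)
    show "feasible \<Omega> a b 1 (S p) (U p)" "P (S p) (U p)" using p by (auto simp: K_def)
    show "h S' U' \<le> h (S p) (U p)" if "feasible \<Omega> a b 1 S' U'" "P S' U'" for S' U'
      using rep[OF that] sup by blast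
  qed
qed

section \<open>Zero-error codes\<close>

definition zero_error_feasible :: "assistance \<Rightarrow> nat \<Rightarrow> nat \<Rightarrow> superop \<Rightarrow> complex mat \<Rightarrow> complex mat \<Rightarrow> bool" where
  "zero_error_feasible \<Omega> a b N S U \<longleftrightarrow>
     feasible \<Omega> a b 1 S U \<and> mat_trace (choi_mat a b N * (kron S (1\<^sub>m b) - U)) = 0"

text \<open>The substitution S = l rho, U = l F, inverted by the factor \<open>1 / l\<close>,
  carries one feasible set onto the other and multiplies the objective by \<open>l\<close>.\<close>

lemma success_prob_eq:
  assumes l: "0 < l"
  shows "success_prob \<Omega> a b N l = Sup {Re (mat_trace (choi_mat a b N * U)) / l | S U.
     feasible \<Omega> a b 1 S U \<and> mat_trace S = complex_of_real l}" (is "_ = Sup ?W")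
proof -
  have J: "Re (mat_trace (choi_mat a b N * (complex_of_real x \<cdot>\<^sub>m F))) = x * Re (mat_trace (choi_mat a b N * F))"
    if "F \<in> carrier_mat (a * b) (a * b)" for x F
    using that choi_mat_carrier[of a b N]
    by (simp add: mult_smult_distrib[OF choi_mat_carrier that] mat_trace_smult[of _ "a * b"])
  define V where "V = {Re (mat_trace (choi_mat a b N * F)) | F \<rho>.
     feasible \<Omega> a b (1 / l) \<rho> F \<and> mat_trace \<rho> = 1}"
  have "success_prob \<Omega> a b N l = Sup V"
    unfolding success_prob_def V_def feasible_iff_loewner
    by (rule arg_cong[of _ _ Sup]) blast
  also have "V = ?W"
  proof (intro subset_antisym subsetI)
    fix x assume "x \<in> V"
    then obtain F \<rho> where x: "x = Re (mat_trace (choi_mat a b N * F))"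
      and F: "feasible \<Omega> a b (1 / l) \<rho> F" and tr: "mat_trace \<rho> = 1" by (auto simp: V_def)
    have c: "F \<in> carrier_mat (a * b) (a * b)" "\<rho> \<in> carrier_mat a a" using F by (auto simp: feasible_def)
    show "x \<in> ?W"
      using feasible_scale[OF F, of l] l tr J[OF c(1), of l] x mat_trace_smult[OF c(2), of "complex_of_real l"]
      by (intro CollectI exI[of _ "complex_of_real l \<cdot>\<^sub>m \<rho>"] exI[of _ "complex_of_real l \<cdot>\<^sub>m F"]) simp
  next
    fix x assume "x \<in> ?W"
    then obtain S U where x: "x = Re (mat_trace (choi_mat a b N * U)) / l"
      and F: "feasible \<Omega> a b 1 S U" and tr: "mat_trace S = complex_of_real l" by auto
    have c: "U \<in> carrier_mat (a * b) (a * b)" "S \<in> carrier_mat a a" using F by (auto simp: feasible_def)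
    show "x \<in> V"
      unfolding V_def
      using feasible_scale[OF F, of "1 / l"] l tr J[OF c(1), of "1 / l"] x
        mat_trace_smult[OF c(2), of "complex_of_real (1 / l)"]
      by (intro CollectI exI[of _ "complex_of_real (1 / l) \<cdot>\<^sub>m U"] exI[of _ "complex_of_real (1 / l) \<cdot>\<^sub>m S"]) simp
  qed
  finally show ?thesis .
qed

context
  fixes a b :: nat and N :: superop and \<Omega> :: assistance
  assumes a: "0 < a" and b: "0 < b" and N: "quantum_channel a b N"
begin

text \<open>As the supremum is attained, it is at least 1 exactly when some pair with Tr S = l has
  Tr J U >= l. Since Tr J U never exceeds Tr S, this says that \<open>J\<close> has trace 0 against
  the slack.\<close>

lemma success_prob_ge_one_iff:
  assumes l: "1 \<le> l"
  shows "1 \<le> success_prob \<Omega> a b N l \<longleftrightarrow>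
    (\<exists>S U. zero_error_feasible \<Omega> a b N S U \<and> Re (mat_trace S) = l)"
proof -
  let ?J = "\<lambda>U. Re (mat_trace (choi_mat a b N * U))"
  let ?P = "\<lambda>S (U :: complex mat). mat_trace S = complex_of_real l"
  obtain S0 U0 where ex: "feasible \<Omega> a b 1 S0 U0" "?P S0 U0"
    using feasible_exists[OF a l] by metis
  obtain S U where SU: "feasible \<Omega> a b 1 S U" "?P S U"
    and sup: "\<And>S' U'. feasible \<Omega> a b 1 S' U' \<Longrightarrow> ?P S' U' \<Longrightarrow> ?J U' \<le> ?J U"
  proof (rule feasible_attains_sup[where P = ?P and c = l and h = "\<lambda>S U. ?J U", OF b _ _ ex])
    show "closed {p :: entries \<times> entries. mat_trace (mat a a (fst p)) = complex_of_real l}"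
      by (intro closed_Collect_eq continuous_on_mat_trace[OF continuous_mat_fst] continuous_on_const)
    show "continuous_on UNIV (\<lambda>p :: entries \<times> entries. ?J (mat (a * b) (a * b) (snd p)))"
      by (intro continuous_on_Re continuous_on_mat_trace_mult[where n = "a * b"] continuous_mat_const choi_mat_carrier
          continuous_mat_snd)
  qed auto
  have "0 < l" using l by simp
  \<comment> \<open>The real \<open>Sup\<close> is evaluated as a maximum, attained at
    \<open>U\<close>.\<close>
  then have "success_prob \<Omega> a b N l = ?J U / l"
    unfolding success_prob_eq[OF \<open>0 < l\<close>]
    using SU sup l by (intro cSup_eq_maximum) (auto intro!: divide_right_mono)
  then have "1 \<le> success_prob \<Omega> a b N l \<longleftrightarrow> l \<le> ?J U" using l by simp
  also have "\<dots> \<longleftrightarrow> (\<exists>S U. zero_error_feasible \<Omega> a b N S U \<and> Re (mat_trace S) = l)"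
  proof
    assume "l \<le> ?J U"
    moreover have "Re (mat_trace S) = l" using SU by simp
    ultimately have "zero_error_feasible \<Omega> a b N S U"
      using feasible_choi_le[OF SU(1) b N] SU(1) by (simp add: zero_error_feasible_def)
    with SU show "\<exists>S U. zero_error_feasible \<Omega> a b N S U \<and> Re (mat_trace S) = l" by (metis Re_complex_of_real)
  next
    assume "\<exists>S U. zero_error_feasible \<Omega> a b N S U \<and> Re (mat_trace S) = l"
    then obtain S' U' where F: "feasible \<Omega> a b 1 S' U'" and l': "Re (mat_trace S') = l"
      and "mat_trace (choi_mat a b N * (kron S' (1\<^sub>m b) - U')) = 0" by (auto simp: zero_error_feasible_def)
    then have "?J U' = l" using feasible_choi_le(2)[OF F b N] by simp
    moreover have "?J U' \<le> ?J U" using sup[OF F] feasible_trace_real[OF F b] l' by simp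
    ultimately show "l \<le> ?J U" by simp
  qed
  finally show ?thesis .
qed

lemma zero_error_messages_is_maximum:
  "\<exists>m. zero_error_messages \<Omega> a b N = ereal m \<and>
     is_maximum m {Re (mat_trace S) | S U. zero_error_feasible \<Omega> a b N S U}"
proof -
  let ?J = "choi_mat a b N"
  let ?P = "\<lambda>S U. mat_trace (?J * (kron S (1\<^sub>m b) - U)) = 0"
  obtain S0 U0 where F0: "feasible \<Omega> a b 1 S0 U0" and D: "kron S0 (1\<^sub>m b) - U0 = 0\<^sub>m (a * b) (a * b)"
    using feasible_exists[OF a order.refl, where b = b and \<Omega> = \<Omega>] by metis
  have P0: "?P S0 U0" unfolding D by (simp add: mat_trace_mult[OF choi_mat_carrier zero_carrier_mat])
  obtain S U where SU: "feasible \<Omega> a b 1 S U" "?P S U"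
    and sup: "\<And>S' U'. feasible \<Omega> a b 1 S' U' \<Longrightarrow> ?P S' U' \<Longrightarrow> Re (mat_trace S') \<le> Re (mat_trace S)"
  proof (rule feasible_attains_sup[OF b _ _ F0, where P = ?P and h = "\<lambda>S U. Re (mat_trace S)"
        and c = "\<Sum>i<a * b. \<Sum>j<a * b. cmod (?J $$ (i, j))"])
    show "closed {p :: entries \<times> entries. ?P (mat a a (fst p)) (mat (a * b) (a * b) (snd p))}"
      by (intro closed_Collect_eq continuous_on_const continuous_on_mat_trace_mult[where n = "a * b"]
          continuous_mat_const choi_mat_carrier continuous_mat_minus continuous_mat_kron_one
          continuous_mat_fst continuous_mat_snd)
    show "continuous_on UNIV (\<lambda>p :: entries \<times> entries. Re (mat_trace (mat a a (fst p))))"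
      by (intro continuous_on_Re continuous_on_mat_trace[OF continuous_mat_fst])
    \<comment> \<open>The constraint gives Tr S = Tr J U, to which
      \<open>feasible_choi_bound\<close> applies.\<close>
    show "Re (mat_trace S) \<le> (\<Sum>i<a * b. \<Sum>j<a * b. cmod (?J $$ (i, j)))"
      if "feasible \<Omega> a b 1 S U" "?P S U" for S U
      using feasible_choi_bound[OF that(1) b, of N] feasible_choi_le(2)[OF that(1) b N] that(2) by simp
  qed (use P0 in auto)
  define m where "m = Re (mat_trace S)"
  define V where "V = {Re (mat_trace S) | S U. zero_error_feasible \<Omega> a b N S U}"
  have V_ge: "1 \<le> l" if "l \<in> V" for l
    using that feasible_trace_ge_one[OF _ b] by (auto simp: V_def zero_error_feasible_def)
  have m: "m \<in> V" "\<And>l. l \<in> V \<Longrightarrow> l \<le> m"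
    using SU sup by (auto simp: m_def V_def zero_error_feasible_def)
  \<comment> \<open>By \<open>V_ge\<close> every value of the program meets the side condition l >=
    1 of the capacity.\<close>
  have "1 \<le> l \<and> 1 - success_prob \<Omega> a b N l \<le> 0 \<longleftrightarrow> l \<in> V" for l
    using success_prob_ge_one_iff[of l] V_ge[of l] by (cases "1 \<le> l") (auto simp: V_def)
  then have "{ereal (log 2 l) | l. 1 \<le> l \<and> 1 - success_prob \<Omega> a b N l \<le> 0} = {ereal (log 2 l) | l. l \<in> V}"
    by simp
  also have "Sup \<dots> = ereal (log 2 m)"
  proof (intro Sup_eqI)
    show "x \<le> ereal (log 2 m)" if "x \<in> {ereal (log 2 l) | l. l \<in> V}" for x
      using that m V_ge by force
    show "ereal (log 2 m) \<le> y" if "\<And>z. z \<in> {ereal (log 2 l) | l. l \<in> V} \<Longrightarrow> z \<le> y" for y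
      using that m(1) by blast
  qed
  finally have "zero_error_messages \<Omega> a b N = ereal m"
    using V_ge[OF m(1)] by (simp add: zero_error_messages_def one_shot_capacity_def)
  with m show ?thesis unfolding V_def[symmetric] is_maximum_def by blast
qed

end

theorem theorem17:
  fixes dA dB :: nat and N :: superop
  assumes "0 < dA" and "0 < dB" and "quantum_channel dA dB N"
  shows
    "(\<exists>m. zero_error_messages NS_PPT dA dB N = ereal m \<and>
        is_maximum m {Re (mat_trace S) | S U.
          S \<in> carrier_mat dA dA \<and> hermitian_mat S \<and>
          U \<in> carrier_mat (dA * dB) (dA * dB) \<and> hermitian_mat U \<and>
          0\<^sub>m (dA * dB) (dA * dB) \<le>\<^sub>L U \<and> U \<le>\<^sub>L kron S (1\<^sub>m dB) \<and>
          ptrace_A dA dB U = 1\<^sub>m dB \<and>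
          mat_trace (choi_mat dA dB N * (kron S (1\<^sub>m dB) - U)) = 0 \<and>
          0\<^sub>m (dA * dB) (dA * dB) \<le>\<^sub>L ptranspose_B dA dB U \<and>
          ptranspose_B dA dB U \<le>\<^sub>L kron S (1\<^sub>m dB)}) \<and>
     (\<exists>m. zero_error_messages NS dA dB N = ereal m \<and>
        is_maximum m {Re (mat_trace S) | S U.
          S \<in> carrier_mat dA dA \<and> hermitian_mat S \<and>
          U \<in> carrier_mat (dA * dB) (dA * dB) \<and> hermitian_mat U \<and>
          0\<^sub>m (dA * dB) (dA * dB) \<le>\<^sub>L U \<and> U \<le>\<^sub>L kron S (1\<^sub>m dB) \<and>
          ptrace_A dA dB U = 1\<^sub>m dB \<and>
          mat_trace (choi_mat dA dB N * (kron S (1\<^sub>m dB) - U)) = 0}) \<and>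
     (\<forall>\<Omega>. zero_error_capacity \<Omega> dA dB N = (SUP n \<in> {1..}. ereal (1 / real n) *
        log2_ereal (zero_error_messages \<Omega> (dA ^ n) (dB ^ n) (tensor_power dA dB N n))))"
proof -
  have one: "complex_of_real 1 \<cdot>\<^sub>m 1\<^sub>m dB = 1\<^sub>m dB" by (intro eq_matI) auto
  have Z: "zero_error_feasible \<Omega> dA dB N S U \<longleftrightarrow>
      S \<in> carrier_mat dA dA \<and> hermitian_mat S \<and>
      U \<in> carrier_mat (dA * dB) (dA * dB) \<and> hermitian_mat U \<and>
      0\<^sub>m (dA * dB) (dA * dB) \<le>\<^sub>L U \<and> U \<le>\<^sub>L kron S (1\<^sub>m dB) \<and>
      ptrace_A dA dB U = 1\<^sub>m dB \<and>
      mat_trace (choi_mat dA dB N * (kron S (1\<^sub>m dB) - U)) = 0 \<and>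
      (\<Omega> = NS_PPT \<longrightarrow> 0\<^sub>m (dA * dB) (dA * dB) \<le>\<^sub>L ptranspose_B dA dB U \<and>
        ptranspose_B dA dB U \<le>\<^sub>L kron S (1\<^sub>m dB))" for \<Omega> S U
  proof -
    \<comment> \<open>For \<open>S\<close> this comes from the positivity of S tensor 1; for
      \<open>U\<close> it is part of \<open>psd_mat\<close>.\<close>
    have "hermitian_mat S" "hermitian_mat U" if "feasible \<Omega> dA dB 1 S U"
      using feasible_hermitian[OF that assms(2)] that by (auto simp: feasible_def psd_mat_def)
    then show ?thesis
      unfolding zero_error_feasible_def feasible_iff_loewner one by blast
  qed
  \<comment> \<open>Fixing the assistance resolves the implication in \<open>Z\<close>, and the
    regularised formula is the defining equation of \<open>zero_error_capacity\<close>.\<close>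
  show ?thesis
    using zero_error_messages_is_maximum[OF assms, of NS_PPT] zero_error_messages_is_maximum[OF assms, of NS]
    unfolding Z zero_error_capacity_def by simp
qed

end
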